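(* Assume that $\mathbf p\in\mathscr Q_k$ and that $G^{(2)}(1)=\mathbb E[N(N-1)]$ is finite. Then there exists $\eta>0$ such that $$\forall m\in\mathbb N,\quad \mathbf p_1(m)\ge\beta:=\min\{\eta^{\mathfrak a}q_{\mathfrak a},\ \mathbf p_1\},$$ where $\mathfrak a:=\inf\{n\ge2:\ q_n\ne0\}$.
   Context: Let $q=(q_n)_{n\in\mathbb N}$ be a probability distribution on $\mathbb N$ with $q_0+q_1=0$, $N$ a random variable of law $q$, $G(s)=\mathbb E[s^N]$, and $k\ge1$ an integer. $\mathscr P_k:=\{\mathbf p=(\mathbf p_0,\dots,\mathbf p_k)\in(\mathbb R_+)^{k+1}:\sum_{i=0}^k\mathbf p_i=1,\ \mathbf p_0<1\}$ and $\mathscr Q_k:=\{\mathbf p\in\mathscr P_k:\ \mathbf p_1\ge\dots\ge\mathbf p_k\}$. The map $H:\mathscr P_k\to\mathscr P_k$ is defined, for $1\le i\le k$, by $$H_i(\mathbf p)=\sum_{n\ge2}q_n\sum_{m_0=0}^{n-1}\binom{n}{m_0}\mathbf p_0^{m_0}\sum_{(m_1,\dots,m_k)\in S^i_{n-m_0}}\binom{n-m_0}{m_1,\dots,m_k}\prod_{j=1}^k\mathbf p_j^{m_j},\qquad H_0(\mathbf p)=1-\sum_{j=1}^kH_j(\mathbf p),$$ with $S^i_r=\{(m_1,\dots,m_k)\in\mathbb N^k:\ m_j<m_i\ \forall j\ne i,\ \sum_{j=1}^km_j=r\}$. For $\mathbf p\in\mathscr P_k$, $\mathbf p(m)=(\mathbf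 p_0(m),\dots,\mathbf p_k(m)):=H^m(\mathbf p)$ (the $m$-th iterate). *)

theory Defs
  imports "HOL-Probability.Probability"
begin

text \<open>
  A real vector with components indexed by 0, ..., k is a function \<open>nat \<Rightarrow> real\<close> that vanishes
  beyond \<open>k\<close>. The law of \<open>N\<close> is a \<open>nat pmf\<close>, and \<open>N\<close> itself is the identity on the probability
  space \<open>measure_pmf q\<close>.
\<close>

definition Pk :: "nat \<Rightarrow> (nat \<Rightarrow> real) set" where
  "Pk k = {p. (\<forall>i\<le>k. 0 \<le> p i) \<and> (\<forall>i>k. p i = 0) \<and> (\<Sum>i=0..k. p i) = 1 \<and> p 0 < 1}"

definition Qk :: "nat \<Rightarrow> (nat \<Rightarrow> real) set" where
  "Qk k = {p \<in> Pk k. \<forall>i j. 1 \<le> i \<and> i \<le> j \<and> j \<le> k \<longrightarrow> p j \<le> p i}"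

definition S :: "nat \<Rightarrow> nat \<Rightarrow> nat \<Rightarrow> (nat \<Rightarrow> nat) set" where
  "S k i r = {m \<in> {1..k} \<rightarrow>\<^sub>E UNIV. (\<forall>j\<in>{1..k} - {i}. m j < m i) \<and> (\<Sum>j=1..k. m j) = r}"

lemma finite_S: "finite (S k i r)"
proof (rule finite_subset)
  show "S k i r \<subseteq> {1..k} \<rightarrow>\<^sub>E {..r}"
  proof
    fix m assume m: "m \<in> S k i r"
    have "m j \<le> r" if "j \<in> {1..k}" for j
      using m member_le_sum[of j "{1..k}" m] that by (auto simp: S_def)
    with m show "m \<in> {1..k} \<rightarrow>\<^sub>E {..r}"
      by (auto simp: S_def PiE_iff)
  qed
qed (intro finite_PiE; simp)

definition multinomial :: "nat \<Rightarrow> nat \<Rightarrow> (nat \<Rightarrow> nat) \<Rightarrow> real" where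
  "multinomial k r m = fact r / (\<Prod>j=1..k. fact (m j))"

text \<open>
  Meaningful for \<open>1 \<le> i \<le> k\<close>; on \<open>Pk k\<close> the \<open>n\<close>-th term of the series is nonnegative and at most
  \<open>pmf q n\<close>, so the series converges absolutely.
\<close>

definition Hcomp :: "nat \<Rightarrow> nat pmf \<Rightarrow> (nat \<Rightarrow> real) \<Rightarrow> nat \<Rightarrow> real" where
  "Hcomp k q p i =
     (\<Sum>\<^sub>\<infinity>n\<in>{2..}. pmf q n *
        (\<Sum>m0=0..n-1. real (n choose m0) * p 0 ^ m0 *
          (\<Sum>m\<in>S k i (n - m0). multinomial k (n - m0) m * (\<Prod>j=1..k. p j ^ m j))))"

definition H :: "nat \<Rightarrow> nat pmf \<Rightarrow> (nat \<Rightarrow> real) \<Rightarrow> nat \<Rightarrow> real" where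
  "H k q p i =
     (if i = 0 then 1 - (\<Sum>j=1..k. Hcomp k q p j)
      else if i \<le> k then Hcomp k q p i
      else 0)"

end

theory Submission
  imports Defs
begin

text \<open>
  If \<open>p 1\<close> is small then so is every \<open>p j\<close> with \<open>j \<ge> 1\<close>, hence \<open>p 0\<close> is close to \<open>1\<close>.
  Colour \<open>1\<close> wins as soon as it is the only nonzero colour and is drawn exactly once, so
  \<open>H\<^sub>1(p) \<ge> p\<^sub>1 G'(p\<^sub>0)\<close>, and \<open>G'(p\<^sub>0) \<ge> 1\<close> near \<open>p\<^sub>0 = 1\<close> because \<open>N \<ge> 2\<close>. Thus \<open>p\<^sub>1\<close> cannot
  decrease when it is at most some \<open>\<eta>\<close>, while for \<open>p\<^sub>1 > \<eta>\<close> the event that \<open>N = \<aa>\<close> and every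
  draw is \<open>1\<close> gives \<open>H\<^sub>1(p) \<ge> \<eta>\<^sup>\<aa> q\<^sub>\<aa>\<close>.
\<close>

section \<open>The multinomial theorem over a finite index set\<close>

text \<open>Extensionality gives each count vector exactly one representative, as in
  \<open>S\<close>; \<open>compositions {1..k} r\<close> contains every
  \<open>S k i r\<close>.\<close>

definition compositions :: "'a set \<Rightarrow> nat \<Rightarrow> ('a \<Rightarrow> nat) set" where
  "compositions A r = {m \<in> A \<rightarrow>\<^sub>E UNIV. sum m A = r}"

lemma finite_compositions:
  assumes "finite A"
  shows "finite (compositions A r)"
proof (rule finite_subset)
  show "compositions A r \<subseteq> A \<rightarrow>\<^sub>E {..r}"
    using assms by (auto simp: compositions_def PiE_iff extensional_def intro: member_le_sum)
qed (use assms in \<open>intro finite_PiE; simp\<close>)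

text \<open>Induction on \<open>A\<close>: the binomial theorem splits off the exponent
  \<open>t\<close> of the new element, and \<open>r choose t\<close> times the multinomial
  coefficient of the remaining exponents is the full coefficient.\<close>

theorem multinomial_theorem:
  fixes x :: "'a \<Rightarrow> real"
  assumes "finite A"
  shows "sum x A ^ r =
    (\<Sum>m\<in>compositions A r. fact r / (\<Prod>j\<in>A. fact (m j)) * (\<Prod>j\<in>A. x j ^ m j))"
  using assms
proof (induction A arbitrary: r rule: finite_induct)
  case empty
  have "compositions ({} :: 'a set) r = (if r = 0 then {\<lambda>_. undefined} else {})" for r :: nat
    by (auto simp: compositions_def)
  then show ?case
    by simp
next
  case (insert a A)
  let ?w = "\<lambda>B r (m :: 'a \<Rightarrow> nat). fact r / (\<Prod>j\<in>B. fact (m j)) * (\<Prod>j\<in>B. x j ^ m j)"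
  have "sum x (insert a A) ^ r = (x a + sum x A) ^ r"
    using insert by simp
  also have "\<dots> = (\<Sum>t\<le>r. real (r choose t) * x a ^ t * sum x A ^ (r - t))"
    by (rule binomial_ring)
  also have "\<dots> = (\<Sum>t\<le>r. \<Sum>g\<in>compositions A (r - t). real (r choose t) * x a ^ t * ?w A (r - t) g)"
    by (simp only: insert.IH sum_distrib_left)
  also have "\<dots> = (\<Sum>(t, g)\<in>(SIGMA t:{..r}. compositions A (r - t)).
      real (r choose t) * x a ^ t * ?w A (r - t) g)"
    by (rule sum.Sigma) (auto simp: finite_compositions insert.hyps)
  also have "\<dots> = (\<Sum>m\<in>compositions (insert a A) r. ?w (insert a A) r m)"
  \<comment> \<open>A pair \<open>(t, g)\<close> corresponds to \<open>g(a := t)\<close>. The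
    inverse resets the value at \<open>a\<close> to \<open>undefined\<close>, so that the rest is
    extensional on \<open>A\<close>.\<close>
  proof (rule sum.reindex_bij_witness
      [where i = "\<lambda>m. (m a, m(a := undefined))" and j = "\<lambda>(t, g). g(a := t)"], goal_cases)
    case (1 tg)
    then show ?case
      using insert.hyps by (auto simp: compositions_def PiE_iff extensional_def fun_eq_iff)
  next
    case (2 tg)
    then obtain t g where tg: "tg = (t, g)" "t \<le> r" "g \<in> compositions A (r - t)"
      by auto
    have "sum (g(a := t)) A = sum g A"
      using insert.hyps by (intro sum.cong) auto
    then show ?case
      using tg insert.hyps by (auto simp: compositions_def PiE_iff extensional_def)
  next
    case (3 m)
    then show ?case
      by simp
  next
    case (4 m)
    have "sum (m(a := undefined)) A = sum m A"
      using insert.hyps by (intro sum.cong) auto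
    then show ?case
      using 4 insert.hyps by (auto simp: compositions_def PiE_iff extensional_def)
  next
    case (5 tg)
    then obtain t g where tg: "tg = (t, g)" "t \<le> r"
      by auto
    have "(\<Prod>j\<in>A. fact ((g(a := t)) j) :: real) = (\<Prod>j\<in>A. fact (g j))"
      "(\<Prod>j\<in>A. x j ^ (g(a := t)) j) = (\<Prod>j\<in>A. x j ^ g j)"
      using insert.hyps by (auto intro!: prod.cong)
    then show ?case
      using insert.hyps tg by (simp add: binomial_fact)
  qed
  finally show ?case .
qed

section \<open>Winning weights of the colours for a fixed number of draws\<close>

text \<open>The total weight of the words of length \<open>r\<close> over the colours
  \<open>1..k\<close> in which \<open>i\<close> occurs strictly more often than every other colour,
  a letter \<open>j\<close> weighing \<open>p j\<close>.\<close>

definition win :: "nat \<Rightarrow> (nat \<Rightarrow> real) \<Rightarrow> nat \<Rightarrow> nat \<Rightarrow> real" where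
  "win k p i r = (\<Sum>m\<in>S k i r. multinomial k r m * (\<Prod>j=1..k. p j ^ m j))"

text \<open>For \<open>p\<close> in \<open>Pk k\<close> and \<open>n \<ge> 1\<close>: the
  probability that \<open>i\<close> wins \<open>n\<close> draws, split by the number
  \<open>m0\<close> of draws of colour 0.\<close>

definition Hterm :: "nat \<Rightarrow> (nat \<Rightarrow> real) \<Rightarrow> nat \<Rightarrow> nat \<Rightarrow> real" where
  "Hterm k p i n = (\<Sum>m0=0..n-1. real (n choose m0) * p 0 ^ m0 * win k p i (n - m0))"

lemma Hcomp_eq: "Hcomp k q p i = (\<Sum>\<^sub>\<infinity>n\<in>{2..}. pmf q n * Hterm k p i n)"
  by (simp add: Hcomp_def Hterm_def win_def)

lemma multinomial_nonneg: "0 \<le> multinomial k r m"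
  by (simp add: multinomial_def prod_nonneg)

lemma win_nonneg:
  assumes "\<And>j. 1 \<le> j \<Longrightarrow> j \<le> k \<Longrightarrow> 0 \<le> p j"
  shows "0 \<le> win k p i r"
  unfolding win_def using assms
  by (intro sum_nonneg mult_nonneg_nonneg multinomial_nonneg prod_nonneg) auto

lemma S_disjoint:
  assumes "i \<in> {1..k}" "l \<in> {1..k}" "i \<noteq> l"
  shows "S k i r \<inter> S k l r = {}"
proof (rule equals0I)
  fix m assume "m \<in> S k i r \<inter> S k l r"
  then have "m l < m i" "m i < m l"
    using assms by (auto simp: S_def)
  then show False
    by simp
qed

text \<open>A strict winner is unique, so the sets \<open>S k i r\<close> are disjoint parts of the
  compositions of \<open>r\<close>. Ties are lost, whence only an inequality.\<close>

lemma sum_win_le: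
  assumes "\<And>j. 1 \<le> j \<Longrightarrow> j \<le> k \<Longrightarrow> 0 \<le> p j"
  shows "(\<Sum>i=1..k. win k p i r) \<le> (\<Sum>j=1..k. p j) ^ r"
proof -
  have "(\<Sum>i=1..k. win k p i r) =
      (\<Sum>m\<in>(\<Union>i\<in>{1..k}. S k i r). multinomial k r m * (\<Prod>j=1..k. p j ^ m j))"
    unfolding win_def
    by (rule sum.UNION_disjoint[symmetric]) (use S_disjoint finite_S in auto)
  also have "\<dots> \<le> (\<Sum>m\<in>compositions {1..k} r. multinomial k r m * (\<Prod>j=1..k. p j ^ m j))"
    using assms
    by (intro sum_mono2 finite_compositions mult_nonneg_nonneg multinomial_nonneg prod_nonneg)
      (auto simp: S_def compositions_def)
  also have "\<dots> = (\<Sum>j=1..k. p j) ^ r"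
    by (simp add: multinomial_theorem multinomial_def)
  finally show ?thesis .
qed

text \<open>Cancelling \<open>x ^ a * y ^ a\<close> leaves
  \<open>x ^ (b - a) \<le> y ^ (b - a)\<close>.\<close>

lemma swap_power_le:
  fixes x y :: real
  assumes "0 \<le> x" "x \<le> y" "a \<le> b"
  shows "x ^ b * y ^ a \<le> x ^ a * y ^ b"
proof -
  have "x ^ a * y ^ a * x ^ (b - a) \<le> x ^ a * y ^ a * y ^ (b - a)"
    using assms by (intro mult_left_mono power_mono) auto
  moreover have "z ^ b = z ^ a * z ^ (b - a)" for z :: real
    using assms by (simp flip: power_add)
  ultimately show ?thesis
    by (metis mult.assoc mult.commute mult.left_commute)
qed

text \<open>Exchanging the counts of two colours sends wins of the one to wins of the other.\<close>

lemma win_mono: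
  assumes nonneg: "\<And>j. 1 \<le> j \<Longrightarrow> j \<le> k \<Longrightarrow> 0 \<le> p j"
    and i: "i \<in> {1..k}" and l: "l \<in> {1..k}" and le: "p i \<le> p l"
  shows "win k p i r \<le> win k p l r"
proof (cases "i = l")
  case False
  let ?s = "\<lambda>m :: nat \<Rightarrow> nat. m \<circ> Transposition.transpose i l"
  have bij: "bij_betw (Transposition.transpose i l) {1..k} {1..k}"
    using i l by (intro bij_betw_imageI) (auto simp: Transposition.transpose_def image_iff)
  have sum_s: "(\<Sum>j=1..k. ?s m j) = (\<Sum>j=1..k. m j)" for m
    using sum.reindex_bij_betw[OF bij, of m] by simp
  have fact_s: "(\<Prod>j=1..k. fact (?s m j) :: real) = (\<Prod>j=1..k. fact (m j))" for m
    using prod.reindex_bij_betw[OF bij, of "\<lambda>j. fact (m j) :: real"] by simp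
  \<comment> \<open>Formulated symmetrically in the two colours, since the reindexing below needs
    the swap in both directions.\<close>
  have s_S: "?s m \<in> S k l' r" if "m \<in> S k i' r" "{i', l'} = {i, l}" for m i' l'
  proof -
    have "?s m \<in> {1..k} \<rightarrow>\<^sub>E UNIV"
      using that(1) i l by (auto simp: S_def PiE_iff extensional_def Transposition.transpose_def)
    moreover have "Transposition.transpose i l l' = i'"
      using that(2) by (auto simp: doubleton_eq_iff)
    moreover have "Transposition.transpose i l j \<in> {1..k} - {i'}" if j: "j \<in> {1..k} - {l'}" for j
      using j i l \<open>{i', l'} = {i, l}\<close>
      by (auto simp: doubleton_eq_iff Transposition.transpose_def split: if_splits)
    moreover have "m j < m i'" if "j \<in> {1..k} - {i'}" for j
      using \<open>m \<in> S k i' r\<close> that by (simp add: S_def)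
    ultimately show ?thesis
      using that sum_s[of m] by (simp add: S_def)
  qed
  \<comment> \<open>Only the factors at \<open>i\<close> and \<open>l\<close> change. As
    \<open>i\<close> wins, \<open>m l < m i\<close>, so the swap moves the larger exponent to the
    larger base \<open>p l\<close>.\<close>
  have prod_le: "(\<Prod>j=1..k. p j ^ m j) \<le> (\<Prod>j=1..k. p j ^ ?s m j)" if "m \<in> S k i r" for m
  proof -
    have split: "(\<Prod>j=1..k. f j) = f i * f l * (\<Prod>j\<in>{1..k} - {i} - {l}. f j)" for f :: "nat \<Rightarrow> real"
      using i l False prod.remove[of "{1..k}" i f] prod.remove[of "{1..k} - {i}" l f]
      by (simp add: mult.assoc)
    have rest: "(\<Prod>j\<in>{1..k} - {i} - {l}. p j ^ ?s m j) = (\<Prod>j\<in>{1..k} - {i} - {l}. p j ^ m j)"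
      by (intro prod.cong) (auto simp: Transposition.transpose_def)
    have "m l < m i"
      using that l False by (auto simp: S_def)
    then have "p i ^ m i * p l ^ m l \<le> p i ^ m l * p l ^ m i"
      using nonneg i le by (intro swap_power_le) auto
    moreover have "0 \<le> (\<Prod>j\<in>{1..k} - {i} - {l}. p j ^ m j)"
      using nonneg by (intro prod_nonneg) auto
    ultimately show ?thesis
      unfolding split[of "\<lambda>j. p j ^ m j"] split[of "\<lambda>j. p j ^ ?s m j"] rest
      by (simp add: mult_right_mono)
  qed
  have "win k p i r \<le> (\<Sum>m\<in>S k i r. multinomial k r (?s m) * (\<Prod>j=1..k. p j ^ ?s m j))"
    unfolding win_def
  proof (rule sum_mono)
    fix m assume "m \<in> S k i r"
    moreover have "multinomial k r (?s m) = multinomial k r m"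
      unfolding multinomial_def fact_s ..
    ultimately show "multinomial k r m * (\<Prod>j=1..k. p j ^ m j)
        \<le> multinomial k r (?s m) * (\<Prod>j=1..k. p j ^ ?s m j)"
      using prod_le multinomial_nonneg by (simp only: mult_left_mono)
  qed
  \<comment> \<open>The swap is an involution, hence its own inverse in the reindexing.\<close>
  also have "\<dots> = win k p l r"
    unfolding win_def
    by (rule sum.reindex_bij_witness[where i = ?s and j = ?s])
      (auto simp: s_S comp_assoc insert_commute simp del: comp_apply)
  finally show ?thesis .
qed simp

section \<open>Lower and upper bounds for a fixed number of draws\<close>

text \<open>Keeps the single outcome in which all \<open>r\<close> draws show \<open>i\<close>;
  since \<open>r > 0\<close>, this is a strict win.\<close>

lemma power_le_win:
  assumes "\<And>j. 1 \<le> j \<Longrightarrow> j \<le> k \<Longrightarrow> 0 \<le> p j" and i: "i \<in> {1..k}" and "r > 0"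
  shows "p i ^ r \<le> win k p i r"
proof -
  define m where "m = (\<lambda>j\<in>{1..k}. if j = i then r else 0)"
  have "m \<in> S k i r"
    using i \<open>r > 0\<close> by (auto simp: m_def S_def sum.delta)
  moreover have "multinomial k r m * (\<Prod>j=1..k. p j ^ m j) = p i ^ r"
  proof -
    have "(\<Prod>j=1..k. fact (m j) :: real) = (\<Prod>j=1..k. if j = i then fact r else 1)"
      "(\<Prod>j=1..k. p j ^ m j) = (\<Prod>j=1..k. if j = i then p i ^ r else 1)"
      by (rule prod.cong; simp add: m_def)+
    then show ?thesis
      using i by (simp add: multinomial_def prod.delta)
  qed
  moreover have "0 \<le> multinomial k r m' * (\<Prod>j=1..k. p j ^ m' j)" for m'
    using assms(1) by (intro mult_nonneg_nonneg multinomial_nonneg prod_nonneg) auto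
  ultimately show ?thesis
    unfolding win_def by (metis (lifting) finite_S member_le_sum)
qed

lemma Hterm_nonneg:
  assumes "\<And>j. j \<le> k \<Longrightarrow> 0 \<le> p j"
  shows "0 \<le> Hterm k p i n"
  unfolding Hterm_def using assms
  by (intro sum_nonneg mult_nonneg_nonneg win_nonneg) auto

lemma Hterm_mono:
  assumes "\<And>j. j \<le> k \<Longrightarrow> 0 \<le> p j" "i \<in> {1..k}" "l \<in> {1..k}" "p i \<le> p l"
  shows "Hterm k p i n \<le> Hterm k p l n"
  unfolding Hterm_def using assms
  by (intro sum_mono mult_left_mono win_mono) auto

text \<open>Keeps the event that \<open>m0\<close> draws show 0 and all others show
  \<open>i\<close>. The cases \<open>m0 = 0\<close> and \<open>m0 = n - 1\<close> yield the two
  lower bounds on \<open>Hcomp\<close> below.\<close>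

lemma Hterm_ge:
  assumes "\<And>j. j \<le> k \<Longrightarrow> 0 \<le> p j" "i \<in> {1..k}" "m0 < n"
  shows "real (n choose m0) * p 0 ^ m0 * p i ^ (n - m0) \<le> Hterm k p i n"
proof -
  have "real (n choose m0) * p 0 ^ m0 * p i ^ (n - m0)
      \<le> real (n choose m0) * p 0 ^ m0 * win k p i (n - m0)"
    using assms by (intro mult_left_mono power_le_win) auto
  also have "\<dots> \<le> Hterm k p i n"
    unfolding Hterm_def using assms
    by (intro member_le_sum[where f = "\<lambda>m0. real (n choose m0) * p 0 ^ m0 * win k p i (n - m0)"]
        mult_nonneg_nonneg win_nonneg) auto
  finally show ?thesis .
qed

lemma PkD:
  assumes "p \<in> Pk k"
  shows "\<And>j. j \<le> k \<Longrightarrow> 0 \<le> p j" "p 0 + (\<Sum>j=1..k. p j) = 1" "p 0 < 1"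
  using assms by (auto simp: Pk_def sum.atLeast_Suc_atMost)

text \<open>By \<open>sum_win_le\<close> the sum is dominated by the binomial expansion of
  \<open>(p 0 + ?s) ^ n\<close>, whose base is 1.\<close>

lemma sum_Hterm_le_1:
  assumes "p \<in> Pk k"
  shows "(\<Sum>i=1..k. Hterm k p i n) \<le> 1"
proof -
  let ?s = "\<Sum>j=1..k. p j"
  note p = PkD[OF assms]
  have s: "0 \<le> ?s"
    using p by (intro sum_nonneg) auto
  have "(\<Sum>i=1..k. Hterm k p i n)
      = (\<Sum>m0=0..n-1. \<Sum>i=1..k. real (n choose m0) * p 0 ^ m0 * win k p i (n - m0))"
    unfolding Hterm_def by (rule sum.swap)
  also have "\<dots> = (\<Sum>m0=0..n-1. real (n choose m0) * p 0 ^ m0 * (\<Sum>i=1..k. win k p i (n - m0)))"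
    by (simp add: sum_distrib_left)
  also have "\<dots> \<le> (\<Sum>m0=0..n-1. real (n choose m0) * p 0 ^ m0 * ?s ^ (n - m0))"
    using p by (intro sum_mono mult_left_mono sum_win_le) auto
  \<comment> \<open>For \<open>n \<ge> 1\<close> this adds the term \<open>m0 = n\<close>, where
    every draw shows 0; for \<open>n = 0\<close> the ranges agree.\<close>
  also have "\<dots> \<le> (\<Sum>m0\<le>n. real (n choose m0) * p 0 ^ m0 * ?s ^ (n - m0))"
    using p s by (intro sum_mono2) auto
  also have "\<dots> = (p 0 + ?s) ^ n"
    by (simp add: binomial_ring)
  finally show ?thesis
    using p by simp
qed

lemma Hterm_le_1:
  assumes "p \<in> Pk k" "i \<in> {1..k}"
  shows "Hterm k p i n \<le> 1"
proof -
  have "Hterm k p i n \<le> (\<Sum>i=1..k. Hterm k p i n)"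
    using assms PkD[OF assms(1)] by (intro member_le_sum[where f = "\<lambda>i. Hterm k p i n"] Hterm_nonneg) auto
  with sum_Hterm_le_1[OF assms(1), of n] show ?thesis
    by simp
qed

section \<open>Summation over the law of \<open>N\<close>\<close>

lemma sum_pmf_le_1: "finite F \<Longrightarrow> sum (pmf q) F \<le> 1"
  using measure_pmf.prob_le_1[of q F] by (simp add: measure_measure_pmf_finite)

lemma summable_pmf_mult:
  fixes f :: "nat \<Rightarrow> real"
  assumes "\<And>n. 0 \<le> f n" "\<And>n. f n \<le> 1"
  shows "(\<lambda>n. pmf q n * f n) summable_on A"
proof (rule nonneg_bdd_above_summable_on)
  show "bdd_above (sum (\<lambda>n. pmf q n * f n) ` {F. F \<subseteq> A \<and> finite F})"
  proof (rule bdd_aboveI2)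
    fix F assume "F \<in> {F. F \<subseteq> A \<and> finite F}"
    then have "(\<Sum>n\<in>F. pmf q n * f n) \<le> (\<Sum>n\<in>F. pmf q n)" "sum (pmf q) F \<le> 1"
      using assms by (auto intro!: sum_mono mult_left_le sum_pmf_le_1)
    then show "(\<Sum>n\<in>F. pmf q n * f n) \<le> 1"
      by simp
  qed
qed (use assms in auto)

lemma summable_Hterm:
  assumes "p \<in> Pk k" "i \<in> {1..k}"
  shows "(\<lambda>n. pmf q n * Hterm k p i n) summable_on A"
  using assms Hterm_le_1 Hterm_nonneg PkD(1) by (intro summable_pmf_mult) auto

lemma Hcomp_nonneg:
  assumes "p \<in> Pk k"
  shows "0 \<le> Hcomp k q p i"
  unfolding Hcomp_eq using PkD(1)[OF assms]
  by (intro infsum_nonneg mult_nonneg_nonneg Hterm_nonneg) auto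

lemma has_sum_finite_sum:
  fixes f :: "'a \<Rightarrow> 'b \<Rightarrow> real"
  assumes "finite I" "\<And>i. i \<in> I \<Longrightarrow> (f i has_sum s i) A"
  shows "((\<lambda>x. \<Sum>i\<in>I. f i x) has_sum sum s I) A"
  using assms by (induction I rule: finite_induct) (auto intro: has_sum_add)

text \<open>Ensures that coordinate 0 of \<open>H k q p\<close> is nonnegative. The finite sum over
  colours is moved inside the series, where each term is at most \<open>pmf q n\<close>.\<close>

lemma sum_Hcomp_le_1:
  assumes "p \<in> Pk k"
  shows "(\<Sum>i=1..k. Hcomp k q p i) \<le> 1"
proof -
  let ?f = "\<lambda>n. \<Sum>i=1..k. Hterm k p i n"
  have "(\<Sum>i=1..k. Hcomp k q p i) = (\<Sum>\<^sub>\<infinity>n\<in>{2..}. \<Sum>i=1..k. pmf q n * Hterm k p i n)"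
    unfolding Hcomp_eq using assms
    by (intro infsumI[symmetric] has_sum_finite_sum has_sum_infsum summable_Hterm) auto
  also have "\<dots> = (\<Sum>\<^sub>\<infinity>n\<in>{2..}. pmf q n * ?f n)"
    by (simp add: sum_distrib_left)
  also have "\<dots> \<le> 1"
  proof (rule infsum_le_finite_sums)
    show "(\<lambda>n. pmf q n * ?f n) summable_on {2..}"
      using assms sum_Hterm_le_1 PkD(1)[OF assms]
      by (intro summable_pmf_mult sum_nonneg Hterm_nonneg) auto
    fix F :: "nat set" assume "finite F"
    have "(\<Sum>n\<in>F. pmf q n * ?f n) \<le> sum (pmf q) F"
      using sum_Hterm_le_1[OF assms] by (intro sum_mono mult_left_le) auto
    also have "\<dots> \<le> 1"
      using \<open>finite F\<close> by (rule sum_pmf_le_1)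
    finally show "(\<Sum>n\<in>F. pmf q n * ?f n) \<le> 1" .
  qed
  finally show ?thesis .
qed

lemma Hcomp_mono:
  assumes "p \<in> Pk k" "i \<in> {1..k}" "l \<in> {1..k}" "p i \<le> p l"
  shows "Hcomp k q p i \<le> Hcomp k q p l"
  unfolding Hcomp_eq using assms PkD(1)[OF assms(1)]
  by (intro infsum_mono summable_Hterm mult_left_mono Hterm_mono) auto

lemma sum_Hterm_le_Hcomp:
  assumes "p \<in> Pk k" "i \<in> {1..k}" "finite F" "F \<subseteq> {2..}"
  shows "(\<Sum>n\<in>F. pmf q n * Hterm k p i n) \<le> Hcomp k q p i"
  unfolding Hcomp_eq using assms PkD(1)[OF assms(1)]
  by (intro finite_sum_le_infsum summable_Hterm mult_nonneg_nonneg Hterm_nonneg) auto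

lemma pmf_mult_power_le_Hcomp:
  assumes "p \<in> Pk k" "i \<in> {1..k}" "a \<ge> 2"
  shows "pmf q a * p i ^ a \<le> Hcomp k q p i"
proof -
  have "pmf q a * p i ^ a \<le> pmf q a * Hterm k p i a"
    using Hterm_ge[OF PkD(1)[OF assms(1)] assms(2), where ?m0.0 = 0 and n = a] \<open>a \<ge> 2\<close>
    by (intro mult_left_mono) auto
  also have "\<dots> \<le> Hcomp k q p i"
    using sum_Hterm_le_Hcomp[OF assms(1,2), of "{a}" q] \<open>a \<ge> 2\<close> by simp
  finally show ?thesis .
qed

text \<open>The sum is the part of \<open>G'(p 0)\<close> with exponents in \<open>F\<close>: for
  each \<open>n\<close>, one draw shows \<open>i\<close> and the other \<open>n - 1\<close> show 0.
  With \<open>F\<close> finite, no derivative of a series is involved.\<close>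

lemma sum_deriv_le_Hcomp:
  assumes "p \<in> Pk k" "i \<in> {1..k}" "finite F" "F \<subseteq> {2..}"
  shows "p i * (\<Sum>n\<in>F. pmf q n * (real n * p 0 ^ (n - 1))) \<le> Hcomp k q p i"
proof -
  have "p i * (\<Sum>n\<in>F. pmf q n * (real n * p 0 ^ (n - 1)))
      = (\<Sum>n\<in>F. pmf q n * (real n * p 0 ^ (n - 1) * p i))"
    by (simp add: sum_distrib_left ac_simps)
  also have "\<dots> \<le> (\<Sum>n\<in>F. pmf q n * Hterm k p i n)"
  proof (intro sum_mono mult_left_mono)
    fix n assume "n \<in> F"
    then have "n \<ge> 2"
      using assms by auto
    moreover have "n choose (n - 1) = n"
      using \<open>n \<ge> 2\<close> binomial_symmetric[of 1 n] by simp
    ultimately show "real n * p 0 ^ (n - 1) * p i \<le> Hterm k p i n"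
      using Hterm_ge[OF PkD(1)[OF assms(1)] assms(2), where ?m0.0 = "n - 1" and n = n] by simp
  qed simp
  also have "\<dots> \<le> Hcomp k q p i"
    by (rule sum_Hterm_le_Hcomp) fact+
  finally show ?thesis .
qed

section \<open>Invariance of \<open>Qk k\<close> under \<open>H\<close>\<close>

text \<open>Since \<open>p 1\<close> dominates the nonzero colours, their total mass
  \<open>1 - p 0\<close> is at most \<open>k * p 1\<close>; \<open>p 1 = 0\<close> would thus force
  \<open>p 0 \<ge> 1\<close>.\<close>

lemma QkD:
  assumes "p \<in> Qk k"
  shows "p \<in> Pk k" "\<And>j. j \<in> {1..k} \<Longrightarrow> p j \<le> p 1" "1 - real k * p 1 \<le> p 0" "k \<ge> 1 \<Longrightarrow> 0 < p 1"
proof -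
  show P: "p \<in> Pk k" and le: "\<And>j. j \<in> {1..k} \<Longrightarrow> p j \<le> p 1"
    using assms by (auto simp: Qk_def)
  have "(\<Sum>j=1..k. p j) \<le> real k * p 1"
    using sum_bounded_above[of "{1..k}" p "p 1"] le by simp
  then show p0: "1 - real k * p 1 \<le> p 0"
    using PkD(2)[OF P] by simp
  show "0 < p 1" if "k \<ge> 1"
    using p0 PkD(1,3)[OF P] that by (cases "p 1 = 0") (auto simp: order_less_le)
qed

lemma H_in_Qk:
  assumes p: "p \<in> Qk k" and "k \<ge> 1" and a: "a \<ge> 2" "pmf q a \<noteq> 0"
  shows "H k q p \<in> Qk k"
proof -
  note P = QkD(1)[OF p]
  \<comment> \<open>A positive chance that colour 1 wins keeps the new coordinate 0 strictly below
    1.\<close>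
  have "0 < pmf q a * p 1 ^ a"
    using QkD(4)[OF p] \<open>k \<ge> 1\<close> a by (simp add: pmf_positive_iff set_pmf_iff)
  also have "\<dots> \<le> Hcomp k q p 1"
    using P a \<open>k \<ge> 1\<close> by (intro pmf_mult_power_le_Hcomp) auto
  also have "\<dots> \<le> (\<Sum>i=1..k. Hcomp k q p i)"
    using \<open>k \<ge> 1\<close> Hcomp_nonneg[OF P] by (intro member_le_sum) auto
  finally have "H k q p 0 < 1"
    by (simp add: H_def)
  moreover have "0 \<le> H k q p i" for i
    using sum_Hcomp_le_1[OF P] Hcomp_nonneg[OF P] by (auto simp: H_def)
  moreover have "(\<Sum>i=0..k. H k q p i) = 1"
    by (simp add: sum.atLeast_Suc_atMost H_def)
  moreover have "H k q p j \<le> H k q p i" if "1 \<le> i" "i \<le> j" "j \<le> k" for i j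
    using that p by (auto simp: H_def Qk_def intro!: Hcomp_mono)
  ultimately show ?thesis
    by (auto simp: Qk_def Pk_def H_def)
qed

section \<open>Vectors with \<open>p 0\<close> close to 1\<close>

lemma finite_sum_pmf_ge:
  fixes q :: "nat pmf"
  assumes "c < 1" "pmf q 0 + pmf q 1 = 0"
  obtains F where "finite F" "F \<subseteq> {2..}" "c < (\<Sum>n\<in>F. pmf q n)"
proof -
  have "(\<lambda>n. \<Sum>i<n. pmf q i) \<longlonglongrightarrow> 1"
    using measure_pmf.finite_Lim_measure_incseq[of "\<lambda>n. {..<n}" q]
    by (simp add: measure_measure_pmf_finite incseq_def lessThan_subset_iff UN_lessThan_UNIV)
  then have "\<forall>\<^sub>F n in sequentially. c < (\<Sum>i<n. pmf q i)"
    using \<open>c < 1\<close> by (rule order_tendstoD)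
  then obtain n where n: "c < (\<Sum>i<n. pmf q i)"
    by (auto simp: eventually_sequentially)
  have q01: "pmf q 0 = 0" "pmf q 1 = 0"
    using assms(2) pmf_nonneg[of q 0] pmf_nonneg[of q 1] by linarith+
  have "(\<Sum>i<n. pmf q i) = (\<Sum>i\<in>{2..<n}. pmf q i)"
  proof (rule sum.mono_neutral_right)
    show "\<forall>i\<in>{..<n} - {2..<n}. pmf q i = 0"
    proof
      fix i assume "i \<in> {..<n} - {2..<n}"
      then have "i = 0 \<or> i = 1"
        by auto
      then show "pmf q i = 0"
        using q01 by auto
    qed
  qed auto
  with n show ?thesis
    by (intro that[of "{2..<n}"]) auto
qed

lemma Hcomp_1_ge_of_small:
  fixes q :: "nat pmf"
  assumes q01: "pmf q 0 + pmf q 1 = 0" and "k \<ge> 1"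
  obtains \<eta> where "\<eta> > 0" "\<And>p. p \<in> Qk k \<Longrightarrow> p 1 \<le> \<eta> \<Longrightarrow> p 1 \<le> Hcomp k q p 1"
proof -
  \<comment> \<open>Every \<open>n\<close> in \<open>F\<close> is at least 2, so mass above 1/2
    makes the truncated derivative \<open>g\<close> exceed 1 at 1. Being a finite sum,
    \<open>g\<close> is continuous there.\<close>
  obtain F where F: "finite F" "F \<subseteq> {2..}" "1 / 2 < (\<Sum>n\<in>F. pmf q n)"
    using finite_sum_pmf_ge[OF _ q01, of "1 / 2"] by auto
  define g where "g x = (\<Sum>n\<in>F. pmf q n * (real n * x ^ (n - 1)))" for x :: real
  have "1 < (\<Sum>n\<in>F. pmf q n * 2)"
    using F by (simp flip: sum_distrib_right)
  also have "\<dots> \<le> g 1"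
    unfolding g_def using F(2) by (auto intro!: sum_mono mult_left_mono)
  finally have "1 < g 1" .
  moreover have "isCont g 1"
    unfolding g_def by (intro continuous_intros)
  ultimately have "\<forall>\<^sub>F x in at 1. 1 < g x"
    by (auto simp: isCont_def intro: order_tendstoD)
  then obtain d where d: "d > 0" "\<And>x. x \<noteq> 1 \<Longrightarrow> dist x 1 < d \<Longrightarrow> 1 < g x"
    by (auto simp: eventually_at)
  show ?thesis
  proof
    \<comment> \<open>Chosen so that \<open>1 - p 0 \<le> k * p 1 \<le> d / 2 < d\<close>, which
      places \<open>p 0\<close> within \<open>d\<close> of 1.\<close>
    show "d / (2 * real k) > 0"
      using d \<open>k \<ge> 1\<close> by simp
    fix p assume p: "p \<in> Qk k" and "p 1 \<le> d / (2 * real k)"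
    then have "real k * p 1 < d"
      using \<open>k \<ge> 1\<close> d by (simp add: field_simps)
    then have "1 < g (p 0)"
      using QkD(1,3)[OF p] PkD(3)[of p k] by (intro d) (auto simp: dist_real_def)
    then have "p 1 \<le> p 1 * g (p 0)"
      using QkD(4)[OF p] \<open>k \<ge> 1\<close> by simp
    also have "\<dots> \<le> Hcomp k q p 1"
      unfolding g_def using F QkD(1)[OF p] \<open>k \<ge> 1\<close> by (intro sum_deriv_le_Hcomp) auto
    finally show "p 1 \<le> Hcomp k q p 1" .
  qed
qed

section \<open>The uniform lower bound along the iterates\<close>

theorem lemma2p2:
  fixes q :: "nat pmf" and k :: nat and p :: "nat \<Rightarrow> real"
  assumes "pmf q 0 + pmf q 1 = 0"
    and "k \<ge> 1"
    and "p \<in> Qk k"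
    and "integrable (measure_pmf q) (\<lambda>n. real n * (real n - 1))"
  shows "\<exists>\<eta>>0. \<forall>m. (H k q ^^ m) p 1
           \<ge> (let a = Inf {n. n \<ge> 2 \<and> pmf q n \<noteq> 0} in min (\<eta> ^ a * pmf q a) (p 1))"
proof -
  define a where "a = Inf {n. n \<ge> 2 \<and> pmf q n \<noteq> 0}"
  \<comment> \<open>Positive mass on \<open>{2..}\<close> makes the set defining \<open>a\<close>
    nonempty, so its infimum is attained.\<close>
  obtain F where F: "F \<subseteq> {2..}" "0 < (\<Sum>n\<in>F. pmf q n)"
    using finite_sum_pmf_ge[OF _ assms(1), of 0] by auto
  obtain n where "n \<in> F" "pmf q n \<noteq> 0"
    using F(2) by (metis less_irrefl sum.neutral)
  with F(1) have "{n. n \<ge> 2 \<and> pmf q n \<noteq> 0} \<noteq> {}"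
    by auto
  then have "a \<in> {n. n \<ge> 2 \<and> pmf q n \<noteq> 0}"
    unfolding a_def by (rule Inf_nat_def1)
  then have a: "a \<ge> 2" "pmf q a \<noteq> 0"
    by auto
  obtain \<eta> where \<eta>: "\<eta> > 0" "\<And>p. p \<in> Qk k \<Longrightarrow> p 1 \<le> \<eta> \<Longrightarrow> p 1 \<le> Hcomp k q p 1"
    using Hcomp_1_ge_of_small[OF assms(1,2)] by blast
  \<comment> \<open>Membership in \<open>Qk k\<close> is carried through the induction because the
    choice of \<eta> controls \<open>Hcomp\<close> only there.\<close>
  have "(H k q ^^ m) p \<in> Qk k \<and> min (\<eta> ^ a * pmf q a) (p 1) \<le> (H k q ^^ m) p 1" for m
  proof (induction m)
    case 0
    then show ?case
      using assms(3) by simp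
  next
    case (Suc m)
    define x where "x = (H k q ^^ m) p"
    have x: "x \<in> Qk k" "min (\<eta> ^ a * pmf q a) (p 1) \<le> x 1"
      using Suc by (auto simp: x_def)
    have "min (\<eta> ^ a * pmf q a) (p 1) \<le> Hcomp k q x 1"
    proof (cases "x 1 \<le> \<eta>")
      case True
      then show ?thesis
        using \<eta>(2)[OF x(1)] x(2) by linarith
    next
      case False
      then have "pmf q a * \<eta> ^ a \<le> pmf q a * x 1 ^ a"
        using \<eta>(1) by (intro mult_left_mono power_mono) auto
      also have "\<dots> \<le> Hcomp k q x 1"
        using QkD(1)[OF x(1)] a assms(2) by (intro pmf_mult_power_le_Hcomp) auto
      finally show ?thesis
        by (simp add: mult.commute)
    qed
    moreover have "H k q x 1 = Hcomp k q x 1"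
      using assms(2) by (simp add: H_def)
    ultimately show ?case
      using H_in_Qk[OF x(1) assms(2) a] by (simp add: x_def)
  qed
  with \<eta>(1) show ?thesis
    unfolding Let_def a_def[symmetric] by (intro exI[of _ \<eta>]) auto
qed

end
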